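(* The minimal degree $d_f(\mathcal{A})$ of a finite polynomial vector field fixing $\mathcal{A}$ is not determined by the number of lines and singular points counted with multiplicities of $\mathcal{A}$. That is, there exist two real line arrangements $\mathcal{A},\mathcal{A}'$ in $\mathbb{R}^2$ with the same number of lines and such that, for every $k\geq 2$, $\mathcal{A}$ and $\mathcal{A}'$ have the same number of singular points of multiplicity $k$, but $d_f(\mathcal{A})\neq d_f(\mathcal{A}')$.
   Context: A real line arrangement is a finite nonempty set $\mathcal{A}$ of distinct (affine) lines in $\mathbb{R}^2$. A singular point of $\mathcal{A}$ is a point of $\mathbb{R}^2$ lying on at least two lines of $\mathcal{A}$; its multiplicity is the number of lines of $\mathcal{A}$ containing it. A polynomial vector field is $\chi=P\partial_x+Q\partial_y$ with $P,Q\in\mathbb{R}[x,y]$; its degree is $\max\{\deg P,\deg Q\}$. A line $L$ with degree-one equation $\alpha_L=0$ is invariant by (fixed by) $\chi$ if it is invariant under the flow of $\chi$, equivalently if $\alpha_L$ divides $\chi\alpha_L$ in $\mathbb{R}[x,y]$. $\mathcal{D}(\mathcal{A})$ is the set of polynomial vector fields $\chi$ with $\chi\mathcal{Q}_{\mathcal{A}}\in(\mathcal{Q}_{\mathcal{A}})$, where $\mathcal{Q}_{\mathcal{A}}=\prod_{L\in\mathcal{A}}\alpha_L$; equivalently, the set of $\chi$ for which every line of $\mathcal{A}$ is invariant. $d_f(\mathcal{A})$ is the minimal degree of an element $\chi\in\mathcal{D}(\mathcal{A})$ such that only finitely many lines of $\mathbb{R}^2$ are invariant by $\chi$. *)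

theory Defs
  imports "HOL-Analysis.Analysis" "HOL-Computational_Algebra.Computational_Algebra"
begin

text \<open>
  The ring R[x,y] is represented as (R[x])[y], with R the reals: the coefficient of
  x^i y^j in \<open>p\<close> is \<open>coeff (coeff p j) i\<close>.
\<close>

type_synonym bipoly = "real poly poly"

definition eval2 :: "bipoly \<Rightarrow> real \<times> real \<Rightarrow> real" where
  "eval2 p z = poly (poly p [:snd z:]) (fst z)"

text \<open>The total degree, with the convention that the zero polynomial has degree 0.\<close>

definition total_degree :: "bipoly \<Rightarrow> nat" where
  "total_degree p = Max (insert 0 {i + j | i j. coeff (coeff p j) i \<noteq> 0})"

definition partial_x :: "bipoly \<Rightarrow> bipoly" where
  "partial_x p = map_poly pderiv p"

definition partial_y :: "bipoly \<Rightarrow> bipoly" where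
  "partial_y p = pderiv p"


text \<open>The pair \<open>(P, Q)\<close> stands for the vector field P d/dx + Q d/dy.\<close>

type_synonym vector_field = "bipoly \<times> bipoly"

definition vf_apply :: "vector_field \<Rightarrow> bipoly \<Rightarrow> bipoly" where
  "vf_apply \<theta> p = fst \<theta> * partial_x p + snd \<theta> * partial_y p"

definition vf_degree :: "vector_field \<Rightarrow> nat" where
  "vf_degree \<theta> = max (total_degree (fst \<theta>)) (total_degree (snd \<theta>))"


definition is_line :: "(real \<times> real) set \<Rightarrow> bool" where
  "is_line L \<longleftrightarrow> affine L \<and> aff_dim L = 1"

definition is_line_equation :: "bipoly \<Rightarrow> (real \<times> real) set \<Rightarrow> bool" where
  "is_line_equation \<alpha> L \<longleftrightarrow> total_degree \<alpha> = 1 \<and> L = {z. eval2 \<alpha> z = 0}"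

lemma is_line_iff_equation: "is_line L \<longleftrightarrow> (\<exists>\<alpha>. is_line_equation \<alpha> L)"
proof
  assume L: "is_line L"
  then have "affine hull L = L"
    by (simp add: is_line_def affine_hull_eq)
  moreover have "aff_dim L = DIM(real \<times> real) - 1"
    using L by (simp add: is_line_def)
  ultimately obtain n :: "real \<times> real" and c where n: "n \<noteq> 0" "L = {z. n \<bullet> z = c}"
    by (metis aff_dim_eq_hyperplane)
  define a b where "a = fst n" and "b = snd n"
  let ?\<alpha> = "[:[:-c, a:], [:b:]:]"
  have ab: "a \<noteq> 0 \<or> b \<noteq> 0"
    using n(1) by (auto simp: a_def b_def prod_eq_iff)
  have "i + j \<in> {0, 1}" if "coeff (coeff ?\<alpha> j) i \<noteq> 0" for i j
    using that by (cases j; cases i; auto simp: coeff_pCons split: nat.splits)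
  then have "{i + j | i j. coeff (coeff ?\<alpha> j) i \<noteq> 0} \<subseteq> {0, 1}"
    by blast
  moreover have "1 \<in> {i + j | i j. coeff (coeff ?\<alpha> j) i \<noteq> 0}"
  proof (cases "a = 0")
    case True
    then have "1 = 0 + (1::nat) \<and> coeff (coeff ?\<alpha> 1) 0 \<noteq> 0"
      using ab by simp
    then show ?thesis by blast
  next
    case False
    then have "1 = 1 + (0::nat) \<and> coeff (coeff ?\<alpha> 0) 1 \<noteq> 0"
      by simp
    then show ?thesis by blast
  qed
  ultimately have "insert 0 {i + j | i j. coeff (coeff ?\<alpha> j) i \<noteq> 0} = {0, 1}"
    by blast
  then have "total_degree ?\<alpha> = 1"
    by (simp add: total_degree_def)
  moreover have "L = {z. eval2 ?\<alpha> z = 0}"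
    using n(2) by (auto simp: eval2_def a_def b_def inner_prod_def algebra_simps)
  ultimately show "\<exists>\<alpha>. is_line_equation \<alpha> L"
    unfolding is_line_equation_def by blast
next
  assume "\<exists>\<alpha>. is_line_equation \<alpha> L"
  then obtain \<alpha> where deg: "total_degree \<alpha> = 1" and L: "L = {z. eval2 \<alpha> z = 0}"
    by (auto simp: is_line_equation_def)
  let ?S = "{i + j | i j. coeff (coeff \<alpha> j) i \<noteq> 0}"
  have "?S \<subseteq> (\<lambda>(j, i). i + j) ` (SIGMA j:{..degree \<alpha>}. {..degree (coeff \<alpha> j)})"
  proof
    fix d assume "d \<in> ?S"
    then obtain i j where ij: "d = i + j" "coeff (coeff \<alpha> j) i \<noteq> 0" by blast
    then have "coeff \<alpha> j \<noteq> 0" by auto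
    then have "j \<le> degree \<alpha>" "i \<le> degree (coeff \<alpha> j)"
      using ij(2) by (auto intro: le_degree)
    then show "d \<in> (\<lambda>(j, i). i + j) ` (SIGMA j:{..degree \<alpha>}. {..degree (coeff \<alpha> j)})"
      using ij(1) by force
  qed
  then have fin: "finite ?S"
    by (rule finite_subset) auto
  have vanish: "coeff (coeff \<alpha> j) i = 0" if "i + j > 1" for i j
  proof (rule ccontr)
    assume "coeff (coeff \<alpha> j) i \<noteq> 0"
    then have "i + j \<in> insert 0 ?S" by blast
    then have "i + j \<le> total_degree \<alpha>"
      unfolding total_degree_def using fin by (intro Max_ge) auto
    with deg that show False by simp
  qed
  define a b c where "a = coeff (coeff \<alpha> 0) 1" and "b = coeff (coeff \<alpha> 1) 0"
    and "c = coeff (coeff \<alpha> 0) 0"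
  have "total_degree \<alpha> \<in> insert 0 ?S"
    unfolding total_degree_def using fin by (intro Max_in) auto
  with deg obtain i j where ij: "i + j = 1" "coeff (coeff \<alpha> j) i \<noteq> 0" by auto
  have "a \<noteq> 0 \<or> b \<noteq> 0"
  proof (cases j)
    case 0
    then show ?thesis using ij by (simp add: a_def)
  next
    case (Suc k)
    then have "j = 1" "i = 0" using ij(1) by auto
    then show ?thesis using ij(2) by (simp add: b_def)
  qed
  then have nz: "(a, b) \<noteq> 0" by (simp add: prod_eq_iff)
  have "\<alpha> = [:[:c, a:], [:b:]:]"
  proof (intro poly_eqI)
    fix j i
    show "coeff (coeff \<alpha> j) i = coeff (coeff [:[:c, a:], [:b:]:] j) i"
      using vanish[of i j]
      by (auto simp: coeff_pCons a_def b_def c_def split: nat.splits)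
  qed
  then have "L = {z. (a, b) \<bullet> z = -c}"
    unfolding L by (auto simp: eval2_def inner_prod_def algebra_simps)
  then show "is_line L"
    using nz by (simp add: is_line_def affine_hyperplane aff_dim_hyperplane)
qed

text \<open>
  An equation of a line is unique up to a nonzero scalar, and all notions below are
  insensitive to that scalar, so an arbitrary choice is made.
\<close>

definition line_equation :: "(real \<times> real) set \<Rightarrow> bipoly" where
  "line_equation L = (SOME \<alpha>. is_line_equation \<alpha> L)"

definition invariant_line :: "vector_field \<Rightarrow> (real \<times> real) set \<Rightarrow> bool" where
  "invariant_line \<theta> L \<longleftrightarrow> is_line L \<and> line_equation L dvd vf_apply \<theta> (line_equation L)"


definition line_arrangement :: "(real \<times> real) set set \<Rightarrow> bool" where
  "line_arrangement \<A> \<longleftrightarrow> finite \<A> \<and> \<A> \<noteq> {} \<and> (\<forall>L\<in>\<A>. is_line L)"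

definition multiplicity_at :: "(real \<times> real) set set \<Rightarrow> real \<times> real \<Rightarrow> nat" where
  "multiplicity_at \<A> z = card {L \<in> \<A>. z \<in> L}"

definition singular_points :: "(real \<times> real) set set \<Rightarrow> (real \<times> real) set" where
  "singular_points \<A> = {z. multiplicity_at \<A> z \<ge> 2}"

definition defining_poly :: "(real \<times> real) set set \<Rightarrow> bipoly" where
  "defining_poly \<A> = (\<Prod>L\<in>\<A>. line_equation L)"

definition derivations :: "(real \<times> real) set set \<Rightarrow> vector_field set" where
  "derivations \<A> = {\<theta>. defining_poly \<A> dvd vf_apply \<theta> (defining_poly \<A>)}"

text \<open>
  For a line arrangement the minimum is over a nonempty set: multiplying by
  \<open>defining_poly \<A>\<close> a field with finitely many invariant lines gives an element of
  \<open>derivations \<A>\<close> that again has only finitely many invariant lines. The zero field,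
  whose degree is 0 by convention, fixes every line and hence does not compete.
\<close>

definition d_f :: "(real \<times> real) set set \<Rightarrow> nat" where
  "d_f \<A> = (LEAST d. \<exists>\<theta> \<in> derivations \<A>. finite {L. invariant_line \<theta> L} \<and> vf_degree \<theta> = d)"

end

theory Submission
  imports Defs
begin

text \<open>
  Parallel lines have no singular point in the affine plane, so the counts of singular points
  see only the number of parallel pairs and not how these pairs are grouped into directions.
  A field \<open>P \<partial>\<^sub>x + Q \<partial>\<^sub>y\<close> that fixes \<open>n\<close> lines \<open>x = c\<close> and has degree less than \<open>n\<close> satisfies
  \<open>P = 0\<close>, and then it fixes all vertical lines. Hence four parallel lines force \<open>d\<^sub>f \<ge> 4\<close>. The
  \<open>3 \<times> 3\<close> grid also has six parallel pairs, nine double points and six lines, but it is fixed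
  by \<open>p(x) \<partial>\<^sub>x + p(y) \<partial>\<^sub>y\<close> with \<open>p(t) = t(t - 1)(t - 2)\<close>.
\<close>

section \<open>Polynomials in two variables\<close>

lemma eval2_simps [simp]:
  "eval2 (p + q) z = eval2 p z + eval2 q z"
  "eval2 (p - q) z = eval2 p z - eval2 q z"
  "eval2 (p * q) z = eval2 p z * eval2 q z"
  "eval2 (smult r p) z = poly r (fst z) * eval2 p z"
  "eval2 0 z = 0"
  by (simp_all add: eval2_def)

lemma eval2_pCons [simp]: "eval2 (pCons r p) z = poly r (fst z) + snd z * eval2 p z"
  by (simp add: eval2_def)

lemma eval2_fst_fixed: "eval2 p (c, y) = poly (map_poly (\<lambda>r. poly r c) p) y"
  by (induction p) (simp_all add: map_poly_pCons)

text \<open>For fixed c, the restriction to the line x = c is a univariate polynomial in y whose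
  coefficients are the values at c; over an infinite field it vanishes everywhere only if all of
  them do.\<close>

lemma eval2_vertical_zero_iff:
  "(\<forall>y. eval2 p (c, y) = 0) \<longleftrightarrow> (\<forall>j. poly (coeff p j) c = 0)"
proof -
  have "(\<forall>y. eval2 p (c, y) = 0) \<longleftrightarrow> map_poly (\<lambda>r. poly r c) p = 0"
    unfolding eval2_fst_fixed using poly_all_0_iff_0 by blast
  then show ?thesis by (simp add: poly_eq_iff coeff_map_poly)
qed

text \<open>\<open>total_degree\<close> is a \<open>Max\<close>, which says something about its set
  only when that set is finite.\<close>

lemma finite_exponents: "finite {i + j | i j. coeff (coeff (p :: bipoly) j) i \<noteq> 0}"
proof (rule finite_subset)
  show "{i + j | i j. coeff (coeff p j) i \<noteq> 0} \<subseteq>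
          (\<lambda>(j, i). i + j) ` (SIGMA j:{..degree p}. {..degree (coeff p j)})"
  proof
    fix d assume "d \<in> {i + j | i j. coeff (coeff p j) i \<noteq> 0}"
    then obtain i j where ij: "d = i + j" "coeff (coeff p j) i \<noteq> 0" by blast
    then have "coeff p j \<noteq> 0" by auto
    then have "j \<le> degree p" "i \<le> degree (coeff p j)"
      using ij(2) by (auto intro: le_degree)
    then show "d \<in> (\<lambda>(j, i). i + j) ` (SIGMA j:{..degree p}. {..degree (coeff p j)})"
      using ij(1) by force
  qed
qed auto

lemma total_degree_le_iff:
  "total_degree p \<le> n \<longleftrightarrow> (\<forall>i j. coeff (coeff p j) i \<noteq> 0 \<longrightarrow> i + j \<le> n)"
  unfolding total_degree_def by (subst Max_le_iff) (auto intro: finite_exponents)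

lemma degree_coeff_le_total_degree: "degree (coeff p j) \<le> total_degree p"
proof (rule degree_le, intro allI impI)
  fix i assume "total_degree p < i"
  then show "coeff (coeff p j) i = 0"
    using total_degree_le_iff[of p "total_degree p"] by force
qed

section \<open>Leibniz rule for vector fields\<close>

lemma pderiv_sum: "pderiv (\<Sum>i\<in>I. f i) = (\<Sum>i\<in>I. pderiv (f i))"
  using higher_pderiv_sum[of 1 f I] by simp

text \<open>\<open>partial_x\<close> differentiates the coefficients, so the product rule is checked
  on each coefficient: the rule in R[x] is applied to every term of the convolution sum.\<close>

lemma partial_x_mult: "partial_x (p * q) = partial_x p * q + p * partial_x q"
  by (rule poly_eqI)
    (simp add: partial_x_def coeff_map_poly coeff_mult pderiv_sum pderiv_mult sum.distrib,
      simp add: mult.commute add.commute)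

lemma vf_apply_mult: "vf_apply \<theta> (p * q) = vf_apply \<theta> p * q + p * vf_apply \<theta> q"
  by (simp add: vf_apply_def partial_x_mult partial_y_def pderiv_mult algebra_simps)

lemma partial_x_one [simp]: "partial_x 1 = 0"
  by (simp add: partial_x_def one_pCons map_poly_pCons)

lemma vf_apply_prod_dvd:
  assumes "\<And>i. i \<in> I \<Longrightarrow> f i dvd vf_apply \<theta> (f i)"
  shows "(\<Prod>i\<in>I. f i) dvd vf_apply \<theta> (\<Prod>i\<in>I. f i)"
  using assms
proof (induction I rule: infinite_finite_induct)
  case (insert i I)
  then show ?case
    by (simp add: vf_apply_mult mult_dvd_mono dvd_add)
qed (simp_all add: vf_apply_def partial_y_def)

section \<open>Lines and their equations\<close>

text \<open>Every line is \<open>vline c\<close> or \<open>gline m c\<close>, never both, and its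
  parameters are unique. Explicit arrangements can thus be handled by comparing real
  numbers.\<close>

definition vline :: "real \<Rightarrow> (real \<times> real) set" where
  "vline c = {z. fst z = c}"

definition gline :: "real \<Rightarrow> real \<Rightarrow> (real \<times> real) set" where
  "gline m c = {z. snd z = m * fst z + c}"

lemma mem_vline [simp]: "z \<in> vline c \<longleftrightarrow> fst z = c"
  and mem_gline [simp]: "z \<in> gline m c \<longleftrightarrow> snd z = m * fst z + c"
  by (simp_all add: vline_def gline_def)

lemma vline_subset_iff [simp]: "vline c \<subseteq> vline d \<longleftrightarrow> c = d"
  by (auto simp: subset_iff)

lemma not_vline_subset_gline [simp]: "\<not> vline c \<subseteq> gline m d"
proof
  assume "vline c \<subseteq> gline m d"
  then have "(c, m * c + d + 1) \<in> gline m d" by (auto simp: subset_iff)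
  then show False by simp
qed

lemma not_gline_subset_vline [simp]: "\<not> gline m d \<subseteq> vline c"
proof
  assume "gline m d \<subseteq> vline c"
  then have "(c + 1, m * (c + 1) + d) \<in> vline c" by (auto simp: subset_iff)
  then show False by simp
qed

lemma gline_subset_iff [simp]: "gline m c \<subseteq> gline n d \<longleftrightarrow> m = n \<and> c = d"
proof
  assume sub: "gline m c \<subseteq> gline n d"
  from subsetD[OF sub, of "(0, c)"] subsetD[OF sub, of "(1, m + c)"]
  show "m = n \<and> c = d" by simp
qed simp

lemma vline_eq_iff [simp]: "vline c = vline d \<longleftrightarrow> c = d"
  and gline_eq_iff [simp]: "gline m c = gline n d \<longleftrightarrow> m = n \<and> c = d"
  and vline_neq_gline [simp]: "vline c \<noteq> gline m d" "gline m d \<noteq> vline c"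
  using vline_subset_iff gline_subset_iff not_vline_subset_gline not_gline_subset_vline
  by (metis subset_refl)+

lemma total_degree_oneE:
  assumes "total_degree \<alpha> = 1"
  obtains a b c where "\<alpha> = [:[:c, a:], [:b:]:]" "a \<noteq> 0 \<or> b \<noteq> 0"
proof
  have vanish: "coeff (coeff \<alpha> j) i = 0" if "i + j > 1" for i j
    using total_degree_le_iff[of \<alpha> 1] assms that by force
  let ?c = "coeff (coeff \<alpha> 0) 0" and ?a = "coeff (coeff \<alpha> 0) 1" and ?b = "coeff (coeff \<alpha> 1) 0"
  show eq: "\<alpha> = [:[:?c, ?a:], [:?b:]:]"
    by (intro poly_eqI) (use vanish in \<open>auto simp: coeff_pCons split: nat.splits\<close>)
  show "?a \<noteq> 0 \<or> ?b \<noteq> 0"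
  proof (rule ccontr)
    assume "\<not> ?thesis"
    then have "\<alpha> = [:[:?c:]:]" using eq by simp
    then have "total_degree \<alpha> \<le> 0"
      unfolding total_degree_le_iff
      by (metis add_0 coeff_pCons_0 coeff_0 coeff_pCons_Suc gr0_implies_Suc le_refl neq0_conv)
    then show False using assms by simp
  qed
qed

lemma total_degree_one:
  assumes "a \<noteq> 0 \<or> b \<noteq> 0"
  shows "total_degree [:[:c, a:], [:b:]:] = 1"
proof (rule antisym)
  show "total_degree [:[:c, a:], [:b:]:] \<le> 1"
    by (auto simp: total_degree_le_iff coeff_pCons split: nat.splits)
  have "\<not> total_degree [:[:c, a:], [:b:]:] \<le> 0"
  proof
    assume "total_degree [:[:c, a:], [:b:]:] \<le> 0"
    then have *: "\<And>i j. coeff (coeff [:[:c, a:], [:b:]:] j) i \<noteq> 0 \<Longrightarrow> i + j \<le> 0"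
      unfolding total_degree_le_iff by blast
    from *[of 0 1] *[of 1 0] assms show False by auto
  qed
  then show "1 \<le> total_degree [:[:c, a:], [:b:]:]" by simp
qed

text \<open>Dividing by the coefficient of y, or by that of x if the former is zero, leaves a
  constant times a monic linear polynomial. This removes the arbitrary choice made in
  \<open>line_equation\<close>: the constant is a unit.\<close>

lemma is_line_equationE:
  assumes "is_line_equation \<alpha> L"
  obtains (vertical) a c where "a \<noteq> 0" "\<alpha> = [:[:a:]:] * [:[:-c, 1:]:]" "L = vline c"
  | (graph) b m c where "b \<noteq> 0" "\<alpha> = [:[:b:]:] * [:[:-c, -m:], 1:]" "L = gline m c"
proof -
  from assms obtain a b c where \<alpha>: "\<alpha> = [:[:c, a:], [:b:]:]" "a \<noteq> 0 \<or> b \<noteq> 0"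
    unfolding is_line_equation_def by (blast elim: total_degree_oneE)
  have L: "L = {z. eval2 \<alpha> z = 0}"
    using assms by (simp add: is_line_equation_def)
  show thesis
  proof (cases "b = 0")
    case True
    then show thesis
      using \<alpha> L by (intro vertical[of a "-c / a"]) (auto simp: field_simps add_eq_0_iff)
  next
    case False
    define m d where "m = -a / b" and "d = -c / b"
    then have coeffs: "a = -b * m" "c = -b * d" using False by simp_all
    have "eval2 \<alpha> z = b * (snd z - m * fst z - d)" for z
      by (simp add: \<alpha>(1) coeffs algebra_simps)
    then have "L = gline m d"
      using False by (auto simp: L)
    then show thesis
      using False \<alpha>(1) coeffs by (intro graph[of b d m]) (auto simp: one_pCons)
  qed
qed

lemma is_line_vline [simp]: "is_line (vline c)"
proof -
  have "is_line_equation [:[:-c, 1:], [:0:]:] (vline c)"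
    unfolding is_line_equation_def by (subst total_degree_one) auto
  then show ?thesis using is_line_iff_equation by blast
qed

lemma is_line_gline [simp]: "is_line (gline m c)"
proof -
  have "is_line_equation [:[:-c, -m:], [:1:]:] (gline m c)"
    unfolding is_line_equation_def
    by (subst total_degree_one) (auto simp: add_eq_0_iff algebra_simps)
  then show ?thesis using is_line_iff_equation by blast
qed

lemma line_equation: "is_line L \<Longrightarrow> is_line_equation (line_equation L) L"
  unfolding line_equation_def using is_line_iff_equation someI_ex by metis

lemma is_lineE:
  assumes "is_line L"
  obtains (vertical) c where "L = vline c" | (graph) m c where "L = gline m c"
  using line_equation[OF assms] by (cases rule: is_line_equationE) blast+

lemma line_equation_vlineE:
  obtains a where "a \<noteq> 0" "line_equation (vline c) = [:[:a:]:] * [:[:-c, 1:]:]"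
proof -
  have "is_line_equation (line_equation (vline c)) (vline c)"
    by (simp add: line_equation)
  then show thesis by (cases rule: is_line_equationE) (use that in auto)
qed

lemma line_equation_glineE:
  obtains b where "b \<noteq> 0" "line_equation (gline m c) = [:[:b:]:] * [:[:-c, -m:], 1:]"
proof -
  have "is_line_equation (line_equation (gline m c)) (gline m c)"
    by (simp add: line_equation)
  then show thesis by (cases rule: is_line_equationE) (use that in auto)
qed

lemma const_mult_dvd_iff:
  fixes p q :: bipoly
  assumes "a \<noteq> 0"
  shows "[:[:a:]:] * p dvd q \<longleftrightarrow> p dvd q"
proof -
  have "is_unit [:[:a:]:]" using assms by (simp add: is_unit_const_poly_iff dvd_field_iff)
  then show ?thesis by (rule mult_unit_dvd_iff')
qed

text \<open>The bridge from divisibility to pointwise vanishing. The factor x - c lies in the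
  coefficient ring, so it must divide each coefficient. The factor y - (m x + c) is monic in y, so
  the factor theorem over R[x] applies, and a real polynomial in x that vanishes everywhere is
  zero.\<close>

lemma line_equation_dvd_iff:
  assumes "is_line L"
  shows "line_equation L dvd p \<longleftrightarrow> (\<forall>z\<in>L. eval2 p z = 0)"
  using assms
proof (cases rule: is_lineE)
  case (vertical c)
  obtain a where a: "a \<noteq> 0" "line_equation L = [:[:a:]:] * [:[:-c, 1:]:]"
    using line_equation_vlineE vertical by metis
  have "line_equation L dvd p \<longleftrightarrow> (\<forall>j. poly (coeff p j) c = 0)"
    by (simp only: a(2) const_mult_dvd_iff[OF a(1)] const_poly_dvd_iff poly_eq_0_iff_dvd)
  then show ?thesis
    unfolding eval2_vertical_zero_iff[symmetric] vertical by (auto simp: vline_def)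
next
  case (graph m c)
  obtain b where b: "b \<noteq> 0" "line_equation L = [:[:b:]:] * [:-[:c, m:], 1:]"
    using line_equation_glineE[of m c] graph by auto
  have "line_equation L dvd p \<longleftrightarrow> poly p [:c, m:] = 0"
    by (simp only: b(2) const_mult_dvd_iff[OF b(1)] poly_eq_0_iff_dvd)
  also have "\<dots> \<longleftrightarrow> (\<forall>x. poly (poly p [:c, m:]) x = 0)"
    by (simp add: poly_all_0_iff_0)
  also have "\<dots> \<longleftrightarrow> (\<forall>x. eval2 p (x, m * x + c) = 0)"
  proof -
    have "poly (poly p [:c, m:]) x = eval2 p (x, m * x + c)" for x
      by (induction p) (simp_all add: algebra_simps)
    then show ?thesis by simp
  qed
  finally show ?thesis unfolding graph by auto
qed

section \<open>Invariant lines\<close>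

text \<open>The field sends x - c to its first component.\<close>

lemma invariant_vline_iff:
  "invariant_line \<theta> (vline c) \<longleftrightarrow> (\<forall>y. eval2 (fst \<theta>) (c, y) = 0)"
proof -
  obtain a where a: "a \<noteq> 0" "line_equation (vline c) = [:[:a:]:] * [:[:-c, 1:]:]"
    by (rule line_equation_vlineE)
  have "eval2 (vf_apply \<theta> (line_equation (vline c))) z = eval2 (fst \<theta>) z * a" for z
    unfolding a by (simp add: vf_apply_def partial_x_def partial_y_def map_poly_pCons pderiv_pCons)
  then show ?thesis
    using a(1) by (auto simp: invariant_line_def line_equation_dvd_iff)
qed

text \<open>The field P d/dx + Q d/dy sends y - m x - c to Q - m P: along the line it must be
  parallel to (1, m).\<close>

lemma invariant_gline_iff:
  "invariant_line \<theta> (gline m c) \<longleftrightarrow>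
     (\<forall>x. eval2 (snd \<theta>) (x, m * x + c) = m * eval2 (fst \<theta>) (x, m * x + c))"
proof -
  obtain b where b: "b \<noteq> 0" "line_equation (gline m c) = [:[:b:]:] * [:[:-c, -m:], 1:]"
    by (rule line_equation_glineE)
  have "eval2 (vf_apply \<theta> (line_equation (gline m c))) z
      = b * (eval2 (snd \<theta>) z - m * eval2 (fst \<theta>) z)" for z
    unfolding b
    by (simp add: vf_apply_def partial_x_def partial_y_def map_poly_pCons pderiv_pCons
        one_pCons algebra_simps)
  then show ?thesis
    using b(1) by (auto simp: invariant_line_def line_equation_dvd_iff)
qed

section \<open>Derivations of an arrangement as the fields that fix each of its lines\<close>

lemma prime_elem_line_equation:
  assumes "is_line L"
  shows "prime_elem (line_equation L)"
  using assms
proof (cases rule: is_lineE)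
  case (vertical c)
  obtain a where a: "a \<noteq> 0" "line_equation L = [:[:a:]:] * [:[:-c, 1:]:]"
    using line_equation_vlineE vertical by metis
  \<comment> \<open>A linear polynomial is prime in R[x], and a prime of the coefficient ring stays
    prime as a constant of (R[x])[y].\<close>
  have "prime_elem [:[:-c, 1:]:]"
    by (intro lift_prime_elem_poly prime_elem_linear_field_poly) simp
  then show ?thesis
    unfolding a using a(1) by (subst prime_elem_mult_unit_left) (simp_all add: is_unit_const_poly_iff dvd_field_iff)
next
  case (graph m c)
  obtain b where b: "b \<noteq> 0" "line_equation L = [:[:b:]:] * [:-[:c, m:], 1:]"
    using line_equation_glineE[of m c] graph by auto
  \<comment> \<open>Division by y - (m x + c) is tested by substituting m x + c for y, which lands
    in the integral domain R[x].\<close>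
  have "prime_elem [:-[:c, m:], 1:]"
  proof (rule prime_elemI)
    show "\<not> [:-[:c, m:], 1:] dvd 1"
      unfolding poly_eq_0_iff_dvd[symmetric] by simp
  next
    fix p q assume "[:-[:c, m:], 1:] dvd p * q"
    then show "[:-[:c, m:], 1:] dvd p \<or> [:-[:c, m:], 1:] dvd q"
      unfolding poly_eq_0_iff_dvd[symmetric] by simp
  qed simp
  then show ?thesis
    unfolding b using b(1) by (subst prime_elem_mult_unit_left) (simp_all add: is_unit_const_poly_iff dvd_field_iff)
qed

lemma line_subset_imp_eq:
  assumes "is_line L" "is_line L'" "L \<subseteq> L'"
  shows "L = L'"
  using assms(1)
proof (cases rule: is_lineE)
  case (vertical c)
  show ?thesis using assms(2) by (cases rule: is_lineE) (use assms(3) vertical in auto)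
next
  case (graph m c)
  show ?thesis using assms(2) by (cases rule: is_lineE) (use assms(3) graph in auto)
qed

lemma prime_elem_dvd_prodD:
  assumes "prime_elem p" "finite I" "p dvd prod f I"
  shows "\<exists>i\<in>I. p dvd f i"
  using assms(2,3,1) by (induction I) (auto simp: prime_elem_dvd_mult_iff prime_elem_not_unit)

text \<open>Write the defining polynomial as a r with a the equation of L. By Leibniz its image is
  \<open>vf_apply \<theta> a * r + a * vf_apply \<theta> r\<close>, so a divides the first summand.
  As a is prime and does not divide r, the lines being distinct, it divides
  \<open>vf_apply \<theta> a\<close>. The converse is Leibniz over the whole product.\<close>

lemma mem_derivations_iff:
  assumes "line_arrangement \<A>"
  shows "\<theta> \<in> derivations \<A> \<longleftrightarrow> (\<forall>L\<in>\<A>. invariant_line \<theta> L)"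
proof
  assume \<theta>: "\<theta> \<in> derivations \<A>"
  show "\<forall>L\<in>\<A>. invariant_line \<theta> L"
  proof
    fix L assume L: "L \<in> \<A>"
    have fin: "finite \<A>" and lines: "\<And>L. L \<in> \<A> \<Longrightarrow> is_line L"
      using assms by (auto simp: line_arrangement_def)
    let ?\<alpha> = "line_equation L" and ?r = "\<Prod>L'\<in>\<A> - {L}. line_equation L'"
    have prime: "prime_elem ?\<alpha>" by (rule prime_elem_line_equation[OF lines[OF L]])
    have split: "defining_poly \<A> = ?\<alpha> * ?r"
      unfolding defining_poly_def by (rule prod.remove[OF fin L])
    have "?\<alpha> dvd vf_apply \<theta> (defining_poly \<A>)"
      using \<theta> split by (auto simp: derivations_def elim: dvd_mult_left)
    then have "?\<alpha> dvd vf_apply \<theta> ?\<alpha> * ?r"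
      unfolding split vf_apply_mult by (simp add: dvd_add_left_iff)
    moreover have "\<not> ?\<alpha> dvd ?r"
    proof
      assume "?\<alpha> dvd ?r"
      then obtain L' where L': "L' \<in> \<A> - {L}" "?\<alpha> dvd line_equation L'"
        using prime_elem_dvd_prodD[OF prime] fin by blast
      have "is_line_equation (line_equation L') L'"
        using L' lines by (simp add: line_equation)
      then have "L \<subseteq> L'"
        using L'(2) lines[OF L] by (auto simp: line_equation_dvd_iff is_line_equation_def)
      then show False
        using line_subset_imp_eq lines L L'(1) by blast
    qed
    ultimately show "invariant_line \<theta> L"
      using prime lines[OF L] by (auto simp: invariant_line_def prime_elem_dvd_mult_iff)
  qed
qed (auto simp: derivations_def defining_poly_def invariant_line_def intro: vf_apply_prod_dvd)

text \<open>A non-vertical line is recorded by its heights c and m + c over x = 0 and x = 1. In both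
  applications the first component of the field vanishes over these two abscissas, so invariance
  constrains each height separately.\<close>

lemma finite_invariant_lines:
  assumes "finite V" "\<And>c. invariant_line \<theta> (vline c) \<Longrightarrow> c \<in> V"
    and "finite M" "\<And>m c. invariant_line \<theta> (gline m c) \<Longrightarrow> (c, m + c) \<in> M"
  shows "finite {L. invariant_line \<theta> L}"
proof (rule finite_subset)
  show "{L. invariant_line \<theta> L} \<subseteq> vline ` V \<union> (\<lambda>(c, d). gline (d - c) c) ` M"
  proof
    fix L assume "L \<in> {L. invariant_line \<theta> L}"
    then have inv: "invariant_line \<theta> L" and "is_line L"
      by (auto simp: invariant_line_def)
    from this(2) show "L \<in> vline ` V \<union> (\<lambda>(c, d). gline (d - c) c) ` M"
    proof (cases rule: is_lineE)
      case (vertical c)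
      then show ?thesis using assms(2) inv by blast
    next
      case (graph m c)
      then have "(c, m + c) \<in> M" using assms(4) inv by blast
      then show ?thesis using graph by (force simp: image_iff)
    qed
  qed
  show "finite (vline ` V \<union> (\<lambda>(c, d). gline (d - c) c) ` M)"
    using assms by auto
qed

lemma parallel_lines_degree_bound:
  assumes inv: "\<And>c. c \<in> S \<Longrightarrow> invariant_line \<theta> (vline c)"
    and fin: "finite {L. invariant_line \<theta> L}"
  shows "card S \<le> vf_degree \<theta>"
proof (rule ccontr)
  assume less: "\<not> card S \<le> vf_degree \<theta>"
  \<comment> \<open>The coefficient of each power of y is a polynomial in x that vanishes on
    \<open>S\<close> and has degree below \<open>card S\<close>.\<close>
  have "coeff (fst \<theta>) j = 0" for j
  proof (rule ccontr)
    assume nz: "coeff (fst \<theta>) j \<noteq> 0"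
    have "S \<subseteq> {x. poly (coeff (fst \<theta>) j) x = 0}"
      using inv by (auto simp: invariant_vline_iff eval2_vertical_zero_iff)
    then have "card S \<le> degree (coeff (fst \<theta>) j)"
      using card_mono[OF poly_roots_finite[OF nz]] card_poly_roots_bound[OF nz] le_trans by blast
    then show False
      using less degree_coeff_le_total_degree[of "fst \<theta>" j] by (simp add: vf_degree_def)
  qed
  then have "fst \<theta> = 0" by (simp add: poly_eq_iff)
  then have "range vline \<subseteq> {L. invariant_line \<theta> L}"
    by (auto simp: invariant_vline_iff)
  then have "finite (range vline)" using fin finite_subset by blast
  moreover have "inj vline" by (simp add: inj_def)
  ultimately show False
    using finite_imageD infinite_UNIV_char_0 by blast
qed

section \<open>Multiplicities as sums of indicators\<close>

lemma multiplicity_at_insert: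
  assumes "finite \<A>" "L \<notin> \<A>"
  shows "multiplicity_at (insert L \<A>) z = of_bool (z \<in> L) + multiplicity_at \<A> z"
proof -
  have "{L' \<in> insert L \<A>. z \<in> L'} = (if z \<in> L then insert L {L' \<in> \<A>. z \<in> L'} else {L' \<in> \<A>. z \<in> L'})"
    by auto
  then show ?thesis using assms by (simp add: multiplicity_at_def)
qed

lemma multiplicity_at_empty [simp]: "multiplicity_at {} z = 0"
  by (simp add: multiplicity_at_def)

section \<open>The two arrangements\<close>

definition grid :: "(real \<times> real) set set" where
  "grid = {vline 0, vline 1, vline 2, gline 0 0, gline 0 1, gline 0 2}"

text \<open>The two transversals y = 0 and y = x + 1 meet at (-1, 0), off the four vertical lines.
  This avoids triple points and gives 8 + 1 = 9 double points.\<close>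

definition four_parallels :: "(real \<times> real) set set" where
  "four_parallels = {vline 0, vline 1, vline 2, vline 3, gline 0 0, gline 1 1}"

lemma line_arrangement_grid: "line_arrangement grid"
  and line_arrangement_four_parallels: "line_arrangement four_parallels"
  by (auto simp: line_arrangement_def grid_def four_parallels_def)

lemma multiplicity_at_grid:
  "multiplicity_at grid (x, y) = of_bool (x \<in> {0, 1, 2}) + of_bool (y \<in> {0, 1, 2})"
  by (auto simp: grid_def multiplicity_at_insert)

text \<open>The disjunction counts the two transversals once at their common point (-1, 0); the last
  summand restores the second count.\<close>

lemma multiplicity_at_four_parallels:
  "multiplicity_at four_parallels (x, y) =
     of_bool (x \<in> {0, 1, 2, 3}) + of_bool (y = 0 \<or> y = x + 1) + of_bool (x = -1 \<and> y = 0)"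
  by (auto simp: four_parallels_def multiplicity_at_insert)

lemma double_points_grid: "{z. multiplicity_at grid z = 2} = {0, 1, 2} \<times> {0, 1, 2}"
  by (auto simp: multiplicity_at_grid of_bool_def split: if_splits)

lemma double_points_four_parallels:
  "{z. multiplicity_at four_parallels z = 2} =
     {(-1, 0), (0, 0), (1, 0), (2, 0), (3, 0), (0, 1), (1, 2), (2, 3), (3, 4)}"
  by (auto simp: multiplicity_at_four_parallels of_bool_def split: if_splits)

lemma multiplicity_at_le_2:
  "multiplicity_at grid z \<le> 2" "multiplicity_at four_parallels z \<le> 2"
  by (cases z; auto simp: multiplicity_at_grid multiplicity_at_four_parallels of_bool_def)+

lemma card_singular_points:
  assumes "k \<ge> 2"
  shows "card {z \<in> singular_points grid. multiplicity_at grid z = k}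
       = card {z \<in> singular_points four_parallels. multiplicity_at four_parallels z = k}"
proof (cases "k = 2")
  case True
  have "{z \<in> singular_points \<A>. multiplicity_at \<A> z = 2} = {z. multiplicity_at \<A> z = 2}" for \<A>
    by (auto simp: singular_points_def)
  moreover have "card {z. multiplicity_at grid z = 2} = card {z. multiplicity_at four_parallels z = 2}"
    by (simp add: double_points_grid double_points_four_parallels card_cartesian_product)
  ultimately show ?thesis
    unfolding True by simp
next
  case False
  then have "multiplicity_at grid z \<noteq> k" "multiplicity_at four_parallels z \<noteq> k" for z
    using assms multiplicity_at_le_2[of z] by auto
  then show ?thesis by simp
qed

section \<open>Bounds for \<open>d_f\<close> of the two arrangements\<close>

lemma d_f_grid: "d_f grid \<le> 3"
proof -
  \<comment> \<open>Both components have the coefficients of t(t - 1)(t - 2) = t^3 - 3 t^2 + 2 t.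
    The nesting puts x in the inner list and y in the outer one.\<close>
  define \<theta> :: vector_field where
    "\<theta> = ([:[:0, 2, -3, 1:]:], [:0, [:2:], [:-3:], [:1:]:])"
  let ?p = "\<lambda>t::real. t * (t - 1) * (t - 2)"
  have P: "eval2 (fst \<theta>) z = ?p (fst z)" and Q: "eval2 (snd \<theta>) z = ?p (snd z)" for z
    by (simp_all add: \<theta>_def algebra_simps)
  have "\<theta> \<in> derivations grid"
    by (simp add: mem_derivations_iff line_arrangement_grid)
      (simp add: grid_def invariant_vline_iff invariant_gline_iff P Q)
  moreover have "finite {L. invariant_line \<theta> L}"
  proof (rule finite_invariant_lines)
    show "c \<in> {0, 1, 2}" if "invariant_line \<theta> (vline c)" for c
      using that by (auto simp: invariant_vline_iff P)
    show "(c, m + c) \<in> {0, 1, 2} \<times> {0, 1, 2}" if "invariant_line \<theta> (gline m c)" for m c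
    proof -
      have inv: "?p (m * x + c) = m * ?p x" for x
        using that by (simp add: invariant_gline_iff P Q)
      \<comment> \<open>At x = 0 and x = 1 the right-hand side is zero, so c and m + c are roots of
        the cubic.\<close>
      show ?thesis using inv[of 0] inv[of 1] by auto
    qed
  qed auto
  ultimately have "d_f grid \<le> vf_degree \<theta>"
    unfolding d_f_def by (intro Least_le) blast
  also have "\<dots> \<le> 3"
    by (auto simp: vf_degree_def total_degree_le_iff \<theta>_def coeff_pCons split: nat.splits)
  finally show ?thesis .
qed

text \<open>
  \<open>LEAST\<close> is unspecified on an empty set, so a field witnessing that the minimum exists is needed:
  \<open>p y \<partial>\<^sub>x + y (p + y - x - 1) \<partial>\<^sub>y\<close> with \<open>p(x) = x(x - 1)(x - 2)(x - 3)\<close>.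
\<close>

lemma finite_field_four_parallels:
  "\<exists>\<theta> \<in> derivations four_parallels. finite {L. invariant_line \<theta> L}"
proof -
  define p :: "real poly" where "p = [:0, 1:] * [:-1, 1:] * [:-2, 1:] * [:-3, 1:]"
  define \<theta> :: vector_field where
    "\<theta> = ([:p:] * [:0, 1:], [:0, 1:] * ([:p:] + [:[:-1, -1:], 1:]))"
  have p: "poly p x = x * (x - 1) * (x - 2) * (x - 3)" for x
    by (simp add: p_def algebra_simps)
  have P: "eval2 (fst \<theta>) z = poly p (fst z) * snd z"
    and Q: "eval2 (snd \<theta>) z = snd z * (poly p (fst z) + snd z - fst z - 1)" for z
    by (simp_all add: \<theta>_def one_pCons del: mult_pCons_left mult_pCons_right add_pCons)
  \<comment> \<open>The factor p fixes the vertical lines and the factor y of the second component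
    fixes y = 0. On y = x + 1 the second component reduces to y p, equal to the first, as slope 1
    requires.\<close>
  have "\<theta> \<in> derivations four_parallels"
    by (simp add: mem_derivations_iff line_arrangement_four_parallels)
      (simp add: four_parallels_def invariant_vline_iff invariant_gline_iff P Q p)
  moreover have "finite {L. invariant_line \<theta> L}"
  proof (rule finite_invariant_lines)
    show "c \<in> {0, 1, 2, 3}" if "invariant_line \<theta> (vline c)" for c
    proof -
      \<comment> \<open>Any nonzero height would do: at y = 1 the factor y of the first component
        does not vanish, so p(c) = 0.\<close>
      have "eval2 (fst \<theta>) (c, 1) = 0"
        using that unfolding invariant_vline_iff by blast
      then show ?thesis by (auto simp: P p)
    qed
    show "(c, m + c) \<in> {0, 1} \<times> {0, 2}" if "invariant_line \<theta> (gline m c)" for m c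
    proof -
      have inv: "(m * x + c) * (poly p x + (m * x + c) - x - 1) = m * (poly p x * (m * x + c))" for x
        using that by (simp add: invariant_gline_iff P Q)
      \<comment> \<open>Since p vanishes at 0 and 1, these two instances read c (c - 1) = 0 and (m +
        c)(m + c - 2) = 0.\<close>
      show ?thesis using inv[of 0] inv[of 1] by (auto simp: p)
    qed
  qed auto
  ultimately show ?thesis by blast
qed

lemma d_f_four_parallels: "4 \<le> d_f four_parallels"
proof -
  have "\<exists>d. \<exists>\<theta> \<in> derivations four_parallels. finite {L. invariant_line \<theta> L} \<and> vf_degree \<theta> = d"
    using finite_field_four_parallels by blast
  from LeastI_ex[OF this] obtain \<theta> where \<theta>: "\<theta> \<in> derivations four_parallels"
    "finite {L. invariant_line \<theta> L}" "vf_degree \<theta> = d_f four_parallels"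
    unfolding d_f_def by blast
  then have "\<forall>L\<in>four_parallels. invariant_line \<theta> L"
    by (simp add: mem_derivations_iff line_arrangement_four_parallels)
  then have "card {0, 1, 2, 3 :: real} \<le> vf_degree \<theta>"
    using \<theta>(2) by (intro parallel_lines_degree_bound) (auto simp: four_parallels_def)
  then show ?thesis using \<theta>(3) by simp
qed

theorem theorem4p2:
  "\<exists>\<A> \<A>'. line_arrangement \<A> \<and> line_arrangement \<A>' \<and> card \<A> = card \<A>' \<and>
     (\<forall>k\<ge>2. card {z \<in> singular_points \<A>. multiplicity_at \<A> z = k}
            = card {z \<in> singular_points \<A>'. multiplicity_at \<A>' z = k}) \<and>
     d_f \<A> \<noteq> d_f \<A>'"
proof (intro exI conjI allI impI)
  show "line_arrangement grid" "line_arrangement four_parallels"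
    by (rule line_arrangement_grid line_arrangement_four_parallels)+
  show "card grid = card four_parallels"
    by (simp add: grid_def four_parallels_def)
  show "d_f grid \<noteq> d_f four_parallels"
    using d_f_grid d_f_four_parallels by linarith
qed (rule card_singular_points)

end
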